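(* Consider a system $\{R^c : c\in C\}$ of random bunches $R^c=\{R^c_p : p\in P^c\}$ in which every property $p\in P$ enters in exactly two contexts, $C_p=\{c_p,c'_p\}$ with $c_p\neq c'_p$. Then: (i) the minimum possible value of $$\Delta=\sum_{p\in P}\sum_{c\in C_p}\Pr[\hat Q^c_p\neq \hat R^c_p]$$ over all choices of jointly distributed random variables $\{Q_p:p\in P\}$ and all couplings $(\hat R^c,\hat Q^c)$ of $(R^c,Q^c)$, $c\in C$, is the same as the minimum possible value of $$\Delta^{\mathrm{CbD}}=\sum_{p\in P}\Pr[\hat R^{c_p}_p\neq \hat R^{c'_p}_p]$$ over all couplings $\{\hat R^c:c\in C\}$ of $\{R^c:c\in C\}$; (ii) $\Delta_0=\Delta_0^{\mathrm{CbD}}$, where $$\Delta_0=\sum_{p\in P}\ \min_{\text{all choices of }Q_p}\ \sum_{c\in C_p}\ \min_{\text{all couplings }(T_p,S_p)\text{ of }(Q_p,R^c_p)}\Pr[T_p\neq S_p],$$ $$\Delta_0^{\mathrm{CbD}}=\sum_{p\in P}\ \min_{\text{all couplings }(T^{c_p},T^{c'_p})\text{ of }(R^{c_p}_p,R^{c'_p}_p)}\Pr[T^{c_p}\neq T^{c'_p}].$$ Consequently, for such systems the measure of contextuality given by the minimum possible value of $\Delta-\Delta_0$ equals the CbD measure of contextuality given by the minimum possible value of $\Delta^{\mathrm{CbD}}-\Delta_0^{\mathrm{CbD}}$.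
   Context: Setting. $P$ is a finite set of properties and $C$ a finite set of contexts. For each $c\in C$, $P^c\subset P$ is the set of properties that enter in context $c$, and for each $p\in P$, $C_p=\{c\in C: p\in P^c\}$ is the set of contexts in which $p$ enters. For each $c\in C$, the bunch $R^c=\{R^c_p:p\in P^c\}$ is a set of jointly distributed random variables $R^c_p:\Omega_c\to E_p$, with values in arbitrary (measurable) spaces $E_p$ for which events of the form $\{X\ne Y\}$ ($X,Y$ being $E_p$-valued) are measurable. Different bunches need not be defined on a common probability space. A coupling of random variables (or random vectors) $X_1,\dots,X_n$, possibly defined on different probability spaces, is any jointly distributed $(\hat X_1,\dots,\hat X_n)$ with $\hat X_i\sim X_i$ (same distribution) for all $i$. In particular a coupling $\{\hat R^c:c\in C\}$ of the bunches consists of jointly distributed random vectors $\hat R^c=\{\hat R^c_p:p\in P^c\}$ with $\hat R^c\sim R^c$. Given jointly distributed single-indexed random variables $\{Q_p:p\in P\}$, with $Q_p$ taking values in $E_p$, put $Q^c=\{Q_p:p\in P^c\}$ with elements indexed as $Q^c_p=Q_p$. The couplings $(\hat R^c,\hat Q^c)$ of $(R^c,Q^c)$ are chosen separately for each $c$; the components of $\hat Q^c$ are denoted $\hat Q^c_p$, $p\in P^c$. Standing fact assumed for the systems considered: for any joint distribution of $\{Q_p:p\in P\}$ and any couplings $(\hat R^c,\hat Q^c)$ of $(R^c,Q^c)$, $c\in C$, all these random variables can be realized jointly on a common probability space so that $\hat Q^c_p=Q_p$ for all $c\in C$, $p\in P^c$, with the bunches $\{\hat R^c:c\in C\}$ independent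 of each other given $\{Q_p:p\in P\}$ (this is automatic for instance for finite-valued or standard Borel-valued variables). Minimum values are read as infima if not attained. For general systems the CbD quantities are $\Delta^{\mathrm{CbD}}=\sum_{p}\Pr[\hat R^c_p\ne\hat R^{c'}_p\text{ for some }c,c'\in C_p]$ and $\Delta_0^{\mathrm{CbD}}=\sum_p\min\Pr[T^c\neq T^{c'}\text{ for some }c,c'\in C_p]$, the minimum being over couplings $\{T^c:c\in C_p\}$ of $\{R^c_p:c\in C_p\}$; they reduce to the displayed ones when $|C_p|=2$ for all $p$. *)

theory Defs
  imports "HOL-Probability.Probability"
begin

text \<open>
  The value spaces \<open>E p\<close> of all properties are measurable spaces over one type \<open>'a\<close>, and the sample
  spaces \<open>M c\<close> of all bunches are probability spaces over one type \<open>'w\<close>; their carriers and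
  sigma-algebras are arbitrary (and, for \<open>M\<close>, so are the probabilities), so different bunches need
  not live on a common probability space. The measure carried by \<open>E p\<close> is never used.
  \<open>Pc c\<close> is the set of properties entering in context \<open>c\<close>. The assumption \<open>neq_measurable\<close> is the
  measurability of the event that two \<open>E p\<close>-valued variables differ, expressed for the two
  coordinate projections; every other pair of jointly distributed \<open>E p\<close>-valued variables is a
  measurable map into this product.
\<close>

locale random_system =
  fixes P :: "'p set" and C :: "'c set" and Pc :: "'c \<Rightarrow> 'p set"
    and E :: "'p \<Rightarrow> 'a measure" and M :: "'c \<Rightarrow> 'w measure" and R :: "'c \<Rightarrow> 'p \<Rightarrow> 'w \<Rightarrow> 'a"
  assumes finite_P: "finite P"
    and finite_C: "finite C"
    and Pc_subset: "c \<in> C \<Longrightarrow> Pc c \<subseteq> P"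
    and prob_space_M: "c \<in> C \<Longrightarrow> prob_space (M c)"
    and R_measurable: "c \<in> C \<Longrightarrow> p \<in> Pc c \<Longrightarrow> R c p \<in> M c \<rightarrow>\<^sub>M E p"
    and neq_measurable:
      "p \<in> P \<Longrightarrow> {z \<in> space (E p \<Otimes>\<^sub>M E p). fst z \<noteq> snd z} \<in> sets (E p \<Otimes>\<^sub>M E p)"

definition contexts_of :: "'c set \<Rightarrow> ('c \<Rightarrow> 'p set) \<Rightarrow> 'p \<Rightarrow> 'c set" where
  "contexts_of C Pc p = {c \<in> C. p \<in> Pc c}"

definition random_vector :: "'p set \<Rightarrow> ('p \<Rightarrow> 'u \<Rightarrow> 'a) \<Rightarrow> 'u \<Rightarrow> 'p \<Rightarrow> 'a" where
  "random_vector A X \<omega> = (\<lambda>p\<in>A. X p \<omega>)"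

definition vector_law ::
    "'p set \<Rightarrow> ('p \<Rightarrow> 'a measure) \<Rightarrow> 'u measure \<Rightarrow> ('p \<Rightarrow> 'u \<Rightarrow> 'a) \<Rightarrow> ('p \<Rightarrow> 'a) measure" where
  "vector_law A E N X = distr N (Pi\<^sub>M A E) (random_vector A X)"

definition jointly_distributed ::
    "'p set \<Rightarrow> ('p \<Rightarrow> 'a measure) \<Rightarrow> 'u measure \<Rightarrow> ('p \<Rightarrow> 'u \<Rightarrow> 'a) \<Rightarrow> bool" where
  "jointly_distributed A E N X \<longleftrightarrow> prob_space N \<and> (\<forall>p\<in>A. X p \<in> N \<rightarrow>\<^sub>M E p)"

text \<open>
  Being a coupling of random variables depends on these variables only through their laws, so the
  variables to be coupled are represented by their laws \<open>D i\<close> (resp. \<open>\<mu>\<close> and \<open>\<nu>\<close>).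
\<close>

definition coupling ::
    "'i set \<Rightarrow> ('i \<Rightarrow> 'x measure) \<Rightarrow> 'u measure \<Rightarrow> ('i \<Rightarrow> 'u \<Rightarrow> 'x) \<Rightarrow> bool" where
  "coupling I D N X \<longleftrightarrow>
     prob_space N \<and> (\<forall>i\<in>I. X i \<in> N \<rightarrow>\<^sub>M D i \<and> distr N (D i) (X i) = D i)"

definition coupling2 ::
    "'x measure \<Rightarrow> 'y measure \<Rightarrow> 'u measure \<Rightarrow> ('u \<Rightarrow> 'x) \<Rightarrow> ('u \<Rightarrow> 'y) \<Rightarrow> bool" where
  "coupling2 \<mu> \<nu> N X Y \<longleftrightarrow>
     prob_space N \<and> X \<in> N \<rightarrow>\<^sub>M \<mu> \<and> distr N \<mu> X = \<mu> \<and> Y \<in> N \<rightarrow>\<^sub>M \<nu> \<and> distr N \<nu> Y = \<nu>"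

text \<open>\<open>(K, Q)\<close> is a choice of the jointly distributed \<open>Q p\<close>, and \<open>(N c, Rh c, Qh c)\<close> is, separately
  for each context \<open>c\<close>, a coupling of the bunch of \<open>c\<close> with the corresponding subvector of \<open>Q\<close>.\<close>

definition Q_couplings ::
    "'p set \<Rightarrow> 'c set \<Rightarrow> ('c \<Rightarrow> 'p set) \<Rightarrow> ('p \<Rightarrow> 'a measure) \<Rightarrow> ('c \<Rightarrow> 'w measure) \<Rightarrow>
     ('c \<Rightarrow> 'p \<Rightarrow> 'w \<Rightarrow> 'a) \<Rightarrow> 'k measure \<Rightarrow> ('p \<Rightarrow> 'k \<Rightarrow> 'a) \<Rightarrow> ('c \<Rightarrow> 'u measure) \<Rightarrow>
     ('c \<Rightarrow> 'u \<Rightarrow> 'p \<Rightarrow> 'a) \<Rightarrow> ('c \<Rightarrow> 'u \<Rightarrow> 'p \<Rightarrow> 'a) \<Rightarrow> bool" where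
  "Q_couplings P C Pc E M R K Q N Rh Qh \<longleftrightarrow>
     jointly_distributed P E K Q \<and>
     (\<forall>c\<in>C. coupling2 (vector_law (Pc c) E (M c) (R c)) (vector_law (Pc c) E K Q)
                (N c) (Rh c) (Qh c))"

text \<open>
  The sample spaces below range over all probability spaces on a fixed type, namely the type of
  the joint values of the variables concerned. This is no restriction: passing from an arbitrary
  sample space to the joint law changes none of the probabilities involved (see \<open>Delta_in_values\<close>,
  \<open>CbD_Delta_in_values\<close> and \<open>neq_prob_in_values\<close> below).
\<close>

definition Delta ::
    "'p set \<Rightarrow> 'c set \<Rightarrow> ('c \<Rightarrow> 'p set) \<Rightarrow> ('c \<Rightarrow> 'u measure) \<Rightarrow>
     ('c \<Rightarrow> 'u \<Rightarrow> 'p \<Rightarrow> 'a) \<Rightarrow> ('c \<Rightarrow> 'u \<Rightarrow> 'p \<Rightarrow> 'a) \<Rightarrow> real" where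
  "Delta P C Pc N Rh Qh =
     (\<Sum>p\<in>P. \<Sum>c\<in>contexts_of C Pc p. \<P>(\<omega> in N c. Qh c \<omega> p \<noteq> Rh c \<omega> p))"

definition Delta_values ::
    "'p set \<Rightarrow> 'c set \<Rightarrow> ('c \<Rightarrow> 'p set) \<Rightarrow> ('p \<Rightarrow> 'a measure) \<Rightarrow> ('c \<Rightarrow> 'w measure) \<Rightarrow>
     ('c \<Rightarrow> 'p \<Rightarrow> 'w \<Rightarrow> 'a) \<Rightarrow> real set" where
  "Delta_values P C Pc E M R =
     {Delta P C Pc N Rh Qh | (K :: ('p \<Rightarrow> 'a) measure) Q
         (N :: 'c \<Rightarrow> (('p \<Rightarrow> 'a) \<times> ('p \<Rightarrow> 'a)) measure) Rh Qh.
        Q_couplings P C Pc E M R K Q N Rh Qh}"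

definition CbD_Delta ::
    "'p set \<Rightarrow> ('p \<Rightarrow> 'c) \<Rightarrow> ('p \<Rightarrow> 'c) \<Rightarrow> 'u measure \<Rightarrow> ('c \<Rightarrow> 'u \<Rightarrow> 'p \<Rightarrow> 'a) \<Rightarrow> real" where
  "CbD_Delta P c1 c2 N Rh = (\<Sum>p\<in>P. \<P>(\<omega> in N. Rh (c1 p) \<omega> p \<noteq> Rh (c2 p) \<omega> p))"

definition CbD_Delta_values ::
    "'p set \<Rightarrow> 'c set \<Rightarrow> ('c \<Rightarrow> 'p set) \<Rightarrow> ('p \<Rightarrow> 'a measure) \<Rightarrow> ('c \<Rightarrow> 'w measure) \<Rightarrow>
     ('c \<Rightarrow> 'p \<Rightarrow> 'w \<Rightarrow> 'a) \<Rightarrow> ('p \<Rightarrow> 'c) \<Rightarrow> ('p \<Rightarrow> 'c) \<Rightarrow> real set" where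
  "CbD_Delta_values P C Pc E M R c1 c2 =
     {CbD_Delta P c1 c2 N Rh | (N :: ('c \<Rightarrow> 'p \<Rightarrow> 'a) measure) Rh.
        coupling C (\<lambda>c. vector_law (Pc c) E (M c) (R c)) N Rh}"

definition neq_prob_values :: "'a measure \<Rightarrow> 'a measure \<Rightarrow> real set" where
  "neq_prob_values \<mu> \<nu> =
     {\<P>(\<omega> in N. T \<omega> \<noteq> S \<omega>) | (N :: ('a \<times> 'a) measure) T S. coupling2 \<mu> \<nu> N T S}"

definition Delta0 ::
    "'p set \<Rightarrow> 'c set \<Rightarrow> ('c \<Rightarrow> 'p set) \<Rightarrow> ('p \<Rightarrow> 'a measure) \<Rightarrow> ('c \<Rightarrow> 'w measure) \<Rightarrow>
     ('c \<Rightarrow> 'p \<Rightarrow> 'w \<Rightarrow> 'a) \<Rightarrow> real" where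
  "Delta0 P C Pc E M R =
     (\<Sum>p\<in>P. Inf {(\<Sum>c\<in>contexts_of C Pc p.
                     Inf (neq_prob_values (distr K (E p) Qp) (distr (M c) (E p) (R c p))))
                  | (K :: 'a measure) Qp. prob_space K \<and> Qp \<in> K \<rightarrow>\<^sub>M E p})"

definition CbD_Delta0 ::
    "'p set \<Rightarrow> ('p \<Rightarrow> 'a measure) \<Rightarrow> ('c \<Rightarrow> 'w measure) \<Rightarrow> ('c \<Rightarrow> 'p \<Rightarrow> 'w \<Rightarrow> 'a) \<Rightarrow>
     ('p \<Rightarrow> 'c) \<Rightarrow> ('p \<Rightarrow> 'c) \<Rightarrow> real" where
  "CbD_Delta0 P E M R c1 c2 =
     (\<Sum>p\<in>P. Inf (neq_prob_values (distr (M (c1 p)) (E p) (R (c1 p) p))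
                                  (distr (M (c2 p)) (E p) (R (c2 p) p))))"

text \<open>Conditional independence of the variables \<open>X i\<close>, \<open>i \<in> I\<close> (\<open>I\<close> finite), given the
  sub-sigma-algebra \<open>F\<close>. Taking some of the sets \<open>A i\<close> to be the whole space covers the
  subfamilies of \<open>I\<close>.\<close>

definition cond_indep_vars ::
    "'u measure \<Rightarrow> 'u measure \<Rightarrow> 'i set \<Rightarrow> ('i \<Rightarrow> 'x measure) \<Rightarrow> ('i \<Rightarrow> 'u \<Rightarrow> 'x) \<Rightarrow> bool" where
  "cond_indep_vars L F I S X \<longleftrightarrow>
     (\<forall>A. (\<forall>i\<in>I. A i \<in> sets (S i)) \<longrightarrow>
        (AE \<omega> in L. real_cond_exp L F (indicator {\<omega> \<in> space L. \<forall>i\<in>I. X i \<omega> \<in> A i}) \<omega> =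
           (\<Prod>i\<in>I. real_cond_exp L F (indicator {\<omega> \<in> space L. X i \<omega> \<in> A i}) \<omega>)))"

text \<open>For every choice of \<open>Q\<close> and of the couplings of each bunch with its part of \<open>Q\<close>, all these
  variables can be realized on one probability space \<open>L\<close>, as \<open>Q'\<close> and \<open>R' c\<close>, where the role of
  \<open>Qh c\<close> is played by the subvector of \<open>Q'\<close> itself, and with the bunches \<open>R' c\<close> conditionally
  independent given \<open>Q'\<close>.\<close>

definition jointly_realizable ::
    "'p set \<Rightarrow> 'c set \<Rightarrow> ('c \<Rightarrow> 'p set) \<Rightarrow> ('p \<Rightarrow> 'a measure) \<Rightarrow> ('c \<Rightarrow> 'w measure) \<Rightarrow>
     ('c \<Rightarrow> 'p \<Rightarrow> 'w \<Rightarrow> 'a) \<Rightarrow> bool" where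
  "jointly_realizable P C Pc E M R \<longleftrightarrow>
     (\<forall>(K :: ('p \<Rightarrow> 'a) measure) Q (N :: 'c \<Rightarrow> (('p \<Rightarrow> 'a) \<times> ('p \<Rightarrow> 'a)) measure) Rh Qh.
        Q_couplings P C Pc E M R K Q N Rh Qh \<longrightarrow>
        (\<exists>(L :: (('c \<Rightarrow> 'p \<Rightarrow> 'a) \<times> ('p \<Rightarrow> 'a)) measure) R' Q'.
           jointly_distributed P E L Q' \<and>
           vector_law P E L Q' = vector_law P E K Q \<and>
           (\<forall>c\<in>C. R' c \<in> L \<rightarrow>\<^sub>M Pi\<^sub>M (Pc c) E \<and>
              distr L (Pi\<^sub>M (Pc c) E \<Otimes>\<^sub>M Pi\<^sub>M (Pc c) E)
                  (\<lambda>\<omega>. (R' c \<omega>, random_vector (Pc c) Q' \<omega>)) =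
              distr (N c) (Pi\<^sub>M (Pc c) E \<Otimes>\<^sub>M Pi\<^sub>M (Pc c) E) (\<lambda>\<omega>. (Rh c \<omega>, Qh c \<omega>))) \<and>
           cond_indep_vars L (vimage_algebra (space L) (random_vector P Q') (Pi\<^sub>M P E))
             C (\<lambda>c. Pi\<^sub>M (Pc c) E) R'))"


subsection \<open>Independence of the sample spaces, existence of couplings\<close>

lemma sets_vector_law [measurable_cong]: "sets (vector_law A E N X) = sets (Pi\<^sub>M A E)"
  by (simp add: vector_law_def)

lemma measurable_vector_law: "measurable N (vector_law A E N' X) = measurable N (Pi\<^sub>M A E)"
  by (rule measurable_cong_sets) (simp_all add: sets_vector_law)

lemma random_vector_measurable:
  "jointly_distributed A E N X \<Longrightarrow> random_vector A X \<in> N \<rightarrow>\<^sub>M Pi\<^sub>M A E"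
  unfolding jointly_distributed_def random_vector_def [abs_def]
  by (auto intro!: measurable_restrict)

lemma coupling2_joint_law:
  assumes "coupling2 \<mu> \<nu> N X Y"
  shows "coupling2 \<mu> \<nu> (distr N (\<mu> \<Otimes>\<^sub>M \<nu>) (\<lambda>\<omega>. (X \<omega>, Y \<omega>))) fst snd"
proof -
  have [measurable]: "X \<in> N \<rightarrow>\<^sub>M \<mu>" "Y \<in> N \<rightarrow>\<^sub>M \<nu>" and N: "prob_space N"
    and *: "distr N \<mu> X = \<mu>" "distr N \<nu> Y = \<nu>"
    using assms by (auto simp: coupling2_def)
  have "prob_space (distr N (\<mu> \<Otimes>\<^sub>M \<nu>) (\<lambda>\<omega>. (X \<omega>, Y \<omega>)))"
    by (rule prob_space.prob_space_distr [OF N]) measurable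
  then show ?thesis
    using * by (simp add: coupling2_def distr_distr comp_def)
qed

lemma prob_distr_neq:
  assumes f: "f \<in> N \<rightarrow>\<^sub>M S" and g: "g \<in> S \<rightarrow>\<^sub>M E" and h: "h \<in> S \<rightarrow>\<^sub>M E"
    and D: "{z \<in> space (E \<Otimes>\<^sub>M E). fst z \<noteq> snd z} \<in> sets (E \<Otimes>\<^sub>M E)"
  shows "\<P>(x in distr N S f. g x \<noteq> h x) = \<P>(\<omega> in N. g (f \<omega>) \<noteq> h (f \<omega>))"
proof -
  have "(\<lambda>x. (g x, h x)) \<in> S \<rightarrow>\<^sub>M E \<Otimes>\<^sub>M E"
    using g h by measurable
  from measurable_sets [OF this D]
  have "(\<lambda>x. (g x, h x)) -` {z \<in> space (E \<Otimes>\<^sub>M E). fst z \<noteq> snd z} \<inter> space S \<in> sets S" .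
  also have "(\<lambda>x. (g x, h x)) -` {z \<in> space (E \<Otimes>\<^sub>M E). fst z \<noteq> snd z} \<inter> space S =
      {x \<in> space S. g x \<noteq> h x}"
    using g h by (auto simp: space_pair_measure dest: measurable_space)
  finally have "{x \<in> space S. g x \<noteq> h x} \<in> sets S" .
  then have "\<P>(x in distr N S f. g x \<noteq> h x) =
      measure N (f -` {x \<in> space S. g x \<noteq> h x} \<inter> space N)"
    using f by (simp add: measure_distr)
  also have "f -` {x \<in> space S. g x \<noteq> h x} \<inter> space N = {\<omega> \<in> space N. g (f \<omega>) \<noteq> h (f \<omega>)}"
    using f by (auto dest: measurable_space)
  finally show ?thesis .
qed

lemma neq_prob_in_values:
  assumes c: "coupling2 \<mu> \<nu> N T S" and sets: "sets \<mu> = sets E" "sets \<nu> = sets E"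
    and D: "{z \<in> space (E \<Otimes>\<^sub>M E). fst z \<noteq> snd z} \<in> sets (E \<Otimes>\<^sub>M E)"
  shows "\<P>(\<omega> in N. T \<omega> \<noteq> S \<omega>) \<in> neq_prob_values \<mu> \<nu>"
proof -
  have [measurable_cong]: "sets \<mu> = sets E" "sets \<nu> = sets E" by (fact sets)+
  have [measurable]: "T \<in> N \<rightarrow>\<^sub>M \<mu>" "S \<in> N \<rightarrow>\<^sub>M \<nu>" using c by (auto simp: coupling2_def)
  have "\<P>(x in distr N (\<mu> \<Otimes>\<^sub>M \<nu>) (\<lambda>\<omega>. (T \<omega>, S \<omega>)). fst x \<noteq> snd x) =
      \<P>(\<omega> in N. fst (T \<omega>, S \<omega>) \<noteq> snd (T \<omega>, S \<omega>))"
    by (rule prob_distr_neq [OF _ _ _ D]) measurable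
  then show ?thesis
    unfolding neq_prob_values_def using coupling2_joint_law [OF c] by (auto intro!: exI)
qed

lemma coupling2_exists:
  assumes "prob_space \<mu>" "prob_space \<nu>"
  shows "coupling2 \<mu> \<nu> (\<mu> \<Otimes>\<^sub>M \<nu>) fst snd"
proof -
  interpret \<mu>: prob_space \<mu> by fact
  interpret \<nu>: prob_space \<nu> by fact
  interpret pair_prob_space \<mu> \<nu> ..
  have "distr (\<mu> \<Otimes>\<^sub>M \<nu>) \<mu> fst = \<mu>"
    by (rule measure_eqI)
       (simp_all add: emeasure_distr fst_vimage_eq_Times \<nu>.emeasure_pair_measure_Times
          \<nu>.emeasure_space_1 sets.sets_into_space Times_Int_Times Int_absorb2 space_pair_measure)
  moreover have "distr (\<mu> \<Otimes>\<^sub>M \<nu>) \<nu> snd = \<nu>"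
    by (rule measure_eqI)
       (simp_all add: emeasure_distr snd_vimage_eq_Times \<nu>.emeasure_pair_measure_Times
          \<mu>.emeasure_space_1 sets.sets_into_space Times_Int_Times Int_absorb2 space_pair_measure)
  ultimately show ?thesis
    by (simp add: coupling2_def prob_space_axioms)
qed

lemma neq_prob_values_nonempty:
  "prob_space \<mu> \<Longrightarrow> prob_space \<nu> \<Longrightarrow> neq_prob_values \<mu> \<nu> \<noteq> {}"
  using coupling2_exists [of \<mu> \<nu>] by (auto simp: neq_prob_values_def)

lemma neq_prob_values_bdd_below: "bdd_below (neq_prob_values \<mu> \<nu>)"
  by (rule bdd_belowI [of _ 0]) (auto simp: neq_prob_values_def)

context random_system
begin

lemma prob_space_vector_law: "c \<in> C \<Longrightarrow> prob_space (vector_law (Pc c) E (M c) (R c))"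
  unfolding vector_law_def
  by (intro prob_space.prob_space_distr prob_space_M random_vector_measurable)
     (auto simp: jointly_distributed_def prob_space_M R_measurable)

lemma CbD_Delta_values_nonempty: "CbD_Delta_values P C Pc E M R c1 c2 \<noteq> {}"
proof -
  let ?\<mu> = "\<lambda>c. vector_law (Pc c) E (M c) (R c)"
  have "coupling C ?\<mu> (Pi\<^sub>M C ?\<mu>) (\<lambda>c x. x c)"
    using distr_PiM_component [of C ?\<mu>] prob_space_vector_law
    by (auto simp: coupling_def intro!: prob_space_PiM)
  then show ?thesis by (auto simp: CbD_Delta_values_def)
qed

lemma Delta_values_nonempty:
  assumes "\<And>p. p \<in> P \<Longrightarrow> contexts_of C Pc p \<noteq> {}"
  shows "Delta_values P C Pc E M R \<noteq> {}"
proof -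
  have "\<forall>p\<in>P. \<exists>c\<in>C. p \<in> Pc c"
    using assms by (auto simp: contexts_of_def)
  then obtain h where h: "\<And>p. p \<in> P \<Longrightarrow> h p \<in> C \<and> p \<in> Pc (h p)" by metis
  let ?E = "\<lambda>p. distr (M (h p)) (E p) (R (h p) p)"
  let ?K = "Pi\<^sub>M P ?E" and ?Q = "\<lambda>p x. x p"
  have E: "prob_space (?E p)" if "p \<in> P" for p
    using h [OF that] by (intro prob_space.prob_space_distr prob_space_M R_measurable) auto
  have "?Q p \<in> ?K \<rightarrow>\<^sub>M E p" if "p \<in> P" for p
    using measurable_component_singleton [OF that, of ?E] by simp
  then have Q: "jointly_distributed P E ?K ?Q"
    using E by (auto simp: jointly_distributed_def intro!: prob_space_PiM)
  have "prob_space (vector_law (Pc c) E ?K ?Q)" if "c \<in> C" for c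
    unfolding vector_law_def using Q Pc_subset [OF that]
    by (intro prob_space.prob_space_distr random_vector_measurable)
       (auto simp: jointly_distributed_def)
  then have "Q_couplings P C Pc E M R ?K ?Q
      (\<lambda>c. vector_law (Pc c) E (M c) (R c) \<Otimes>\<^sub>M vector_law (Pc c) E ?K ?Q) (\<lambda>_. fst) (\<lambda>_. snd)"
    using Q by (auto simp: Q_couplings_def intro!: coupling2_exists prob_space_vector_law)
  then show ?thesis unfolding Delta_values_def by blast
qed

lemma Delta_values_bdd_below: "bdd_below (Delta_values P C Pc E M R)"
  by (rule bdd_belowI [of _ 0]) (auto simp: Delta_values_def Delta_def intro!: sum_nonneg)

lemma CbD_Delta_values_bdd_below: "bdd_below (CbD_Delta_values P C Pc E M R c1 c2)"
  by (rule bdd_belowI [of _ 0]) (auto simp: CbD_Delta_values_def CbD_Delta_def intro!: sum_nonneg)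

lemma Delta_in_values:
  fixes K :: "'k measure" and N :: "'c \<Rightarrow> 'u measure"
  assumes "Q_couplings P C Pc E M R K Q N Rh Qh"
  shows "Delta P C Pc N Rh Qh \<in> Delta_values P C Pc E M R"
proof -
  let ?\<mu> = "\<lambda>c. vector_law (Pc c) E (M c) (R c)"
  let ?\<nu> = "\<lambda>c. vector_law (Pc c) E K Q"
  let ?K = "vector_law P E K Q" and ?Q = "\<lambda>p x. x p"
  let ?N = "\<lambda>c. distr (N c) (?\<mu> c \<Otimes>\<^sub>M ?\<nu> c) (\<lambda>\<omega>. (Rh c \<omega>, Qh c \<omega>))"
  have Q: "jointly_distributed P E K Q"
    and cpl: "\<And>c. c \<in> C \<Longrightarrow> coupling2 (?\<mu> c) (?\<nu> c) (N c) (Rh c) (Qh c)"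
    using assms by (auto simp: Q_couplings_def)
  have QP: "random_vector P Q \<in> K \<rightarrow>\<^sub>M Pi\<^sub>M P E" by (rule random_vector_measurable [OF Q])
  have K: "prob_space K" using Q by (simp add: jointly_distributed_def)
  have 1: "jointly_distributed P E ?K ?Q"
    using prob_space.prob_space_distr [OF K QP]
    by (auto simp: jointly_distributed_def vector_law_def)
  have 2: "vector_law (Pc c) E ?K ?Q = ?\<nu> c" if "c \<in> C" for c
  proof -
    have "random_vector (Pc c) ?Q \<in> Pi\<^sub>M P E \<rightarrow>\<^sub>M Pi\<^sub>M (Pc c) E"
      using Pc_subset [OF that] unfolding random_vector_def [abs_def]
      by (auto intro!: measurable_restrict)
    moreover have "random_vector (Pc c) ?Q \<circ> random_vector P Q = random_vector (Pc c) Q"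
      using Pc_subset [OF that] by (auto simp: random_vector_def fun_eq_iff restrict_def)
    ultimately show ?thesis
      using QP by (simp add: vector_law_def distr_distr)
  qed
  have 3: "Q_couplings P C Pc E M R ?K ?Q ?N (\<lambda>_. fst) (\<lambda>_. snd)"
    using 1 2 coupling2_joint_law [OF cpl] by (auto simp: Q_couplings_def)
  have "Delta P C Pc N Rh Qh = Delta P C Pc ?N (\<lambda>_. fst) (\<lambda>_. snd)"
    unfolding Delta_def
  proof (intro sum.cong refl)
    fix p c assume p: "p \<in> P" and "c \<in> contexts_of C Pc p"
    then have c: "c \<in> C" "p \<in> Pc c" by (auto simp: contexts_of_def)
    have [measurable]: "Rh c \<in> N c \<rightarrow>\<^sub>M ?\<mu> c" "Qh c \<in> N c \<rightarrow>\<^sub>M ?\<nu> c"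
      using cpl [OF c(1)] by (auto simp: coupling2_def)
    have [measurable]: "(\<lambda>x. x p) \<in> ?\<mu> c \<rightarrow>\<^sub>M E p" "(\<lambda>x. x p) \<in> ?\<nu> c \<rightarrow>\<^sub>M E p"
      using c by (simp_all add: vector_law_def)
    have "\<P>(x in ?N c. snd x p \<noteq> fst x p) =
        \<P>(\<omega> in N c. snd (Rh c \<omega>, Qh c \<omega>) p \<noteq> fst (Rh c \<omega>, Qh c \<omega>) p)"
      by (rule prob_distr_neq [OF _ _ _ neq_measurable [OF p]]) measurable
    then show "\<P>(\<omega> in N c. Qh c \<omega> p \<noteq> Rh c \<omega> p) = \<P>(x in ?N c. snd x p \<noteq> fst x p)"
      by simp
  qed
  then show ?thesis
    unfolding Delta_values_def using 3 by blast
qed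

lemma CbD_Delta_in_values:
  fixes N :: "'u measure"
  assumes cpl: "coupling C (\<lambda>c. vector_law (Pc c) E (M c) (R c)) N Rh"
    and c12: "\<And>p. p \<in> P \<Longrightarrow> {c1 p, c2 p} \<subseteq> contexts_of C Pc p"
  shows "CbD_Delta P c1 c2 N Rh \<in> CbD_Delta_values P C Pc E M R c1 c2"
proof -
  let ?\<mu> = "\<lambda>c. vector_law (Pc c) E (M c) (R c)"
  let ?f = "\<lambda>\<omega>. \<lambda>c\<in>C. Rh c \<omega>"
  let ?N = "distr N (Pi\<^sub>M C ?\<mu>) ?f"
  have N: "prob_space N" and Rh: "\<And>c. c \<in> C \<Longrightarrow> Rh c \<in> N \<rightarrow>\<^sub>M ?\<mu> c"
    and law: "\<And>c. c \<in> C \<Longrightarrow> distr N (?\<mu> c) (Rh c) = ?\<mu> c"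
    using cpl by (auto simp: coupling_def)
  have f: "?f \<in> N \<rightarrow>\<^sub>M Pi\<^sub>M C ?\<mu>" using Rh by (auto intro!: measurable_restrict)
  have "distr ?N (?\<mu> c) (\<lambda>x. x c) = ?\<mu> c" if "c \<in> C" for c
    using that f law by (simp add: distr_distr comp_def)
  then have 1: "coupling C ?\<mu> ?N (\<lambda>c x. x c)"
    using prob_space.prob_space_distr [OF N f] by (auto simp: coupling_def)
  have "CbD_Delta P c1 c2 N Rh = CbD_Delta P c1 c2 ?N (\<lambda>c x. x c)"
    unfolding CbD_Delta_def
  proof (intro sum.cong refl)
    fix p assume p: "p \<in> P"
    then have c: "c1 p \<in> C" "c2 p \<in> C" "p \<in> Pc (c1 p)" "p \<in> Pc (c2 p)"
      using c12 by (auto simp: contexts_of_def)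
    have *: "(\<lambda>x. x c p) \<in> Pi\<^sub>M C ?\<mu> \<rightarrow>\<^sub>M E p" if "c \<in> C" "p \<in> Pc c" for c
    proof -
      have "(\<lambda>x. x p) \<in> ?\<mu> c \<rightarrow>\<^sub>M E p" using that by (simp add: vector_law_def)
      then show ?thesis
        by (rule measurable_compose [OF measurable_component_singleton [OF that(1)]])
    qed
    show "\<P>(\<omega> in N. Rh (c1 p) \<omega> p \<noteq> Rh (c2 p) \<omega> p) = \<P>(x in ?N. x (c1 p) p \<noteq> x (c2 p) p)"
      using prob_distr_neq [OF f *[OF c(1,3)] *[OF c(2,4)] neq_measurable [OF p]] c by simp
  qed
  then show ?thesis
    unfolding CbD_Delta_values_def using 1 by blast
qed

end

end

theory Submission
  imports Defs
begin

text \<open>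
  Taking \<open>Q p\<close> to be the variable of \<open>p\<close> in its first context turns any coupling of the bunches
  into a choice for \<open>\<Delta>\<close> with the same value; conversely, on a joint realization of \<open>Q\<close> and all the
  bunches, \<open>\<Delta>\<close> bounds the CbD sum through the triangle inequality for \<open>\<P>(X \<noteq> Z)\<close>.
  For single variables, couplings over a common \<open>Q p\<close> need not be glueable in general measurable
  spaces. Instead, the least \<open>\<P>(T \<noteq> S)\<close> is identified with a total variation distance, for which
  the triangle inequality is immediate: a maximal coupling exists as soon as the diagonal is
  measurable.
\<close>

section \<open>Disagreement events and the union bound\<close>

lemma neq_event_measurable:
  assumes D: "{z \<in> space (E \<Otimes>\<^sub>M E). fst z \<noteq> snd z} \<in> sets (E \<Otimes>\<^sub>M E)"
    and X: "X \<in> N \<rightarrow>\<^sub>M E" and Y: "Y \<in> N \<rightarrow>\<^sub>M E"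
  shows "{\<omega> \<in> space N. X \<omega> \<noteq> Y \<omega>} \<in> sets N"
proof -
  have "(\<lambda>\<omega>. (X \<omega>, Y \<omega>)) \<in> N \<rightarrow>\<^sub>M E \<Otimes>\<^sub>M E"
    using X Y by measurable
  from measurable_sets [OF this D]
  have "(\<lambda>\<omega>. (X \<omega>, Y \<omega>)) -` {z \<in> space (E \<Otimes>\<^sub>M E). fst z \<noteq> snd z} \<inter> space N \<in> sets N" .
  also have "(\<lambda>\<omega>. (X \<omega>, Y \<omega>)) -` {z \<in> space (E \<Otimes>\<^sub>M E). fst z \<noteq> snd z} \<inter> space N =
      {\<omega> \<in> space N. X \<omega> \<noteq> Y \<omega>}"
    using X Y by (auto simp: space_pair_measure dest: measurable_space)
  finally show ?thesis .
qed

text \<open>Where \<open>X\<close> and \<open>Z\<close> differ, \<open>Y\<close> differs from at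
  least one of them. The order \<open>Y \<noteq> X\<close>, \<open>Y \<noteq> Z\<close> matches the
  summands of \<open>Delta\<close>, with \<open>Y\<close> in the role of \<open>Q p\<close>.\<close>

lemma prob_neq_triangle:
  assumes N: "prob_space N"
    and D: "{z \<in> space (E \<Otimes>\<^sub>M E). fst z \<noteq> snd z} \<in> sets (E \<Otimes>\<^sub>M E)"
    and X: "X \<in> N \<rightarrow>\<^sub>M E" and Y: "Y \<in> N \<rightarrow>\<^sub>M E" and Z: "Z \<in> N \<rightarrow>\<^sub>M E"
  shows "\<P>(\<omega> in N. X \<omega> \<noteq> Z \<omega>) \<le> \<P>(\<omega> in N. Y \<omega> \<noteq> X \<omega>) + \<P>(\<omega> in N. Y \<omega> \<noteq> Z \<omega>)"
proof -
  interpret prob_space N by fact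
  have "{\<omega> \<in> space N. Y \<omega> \<noteq> X \<omega>} \<in> sets N" "{\<omega> \<in> space N. Y \<omega> \<noteq> Z \<omega>} \<in> sets N"
    by (rule neq_event_measurable [OF D]; fact)+
  then show ?thesis
    by (intro order_trans [OF finite_measure_mono measure_Un_le]) auto
qed

section \<open>Sums of measures on a common sigma-algebra\<close>

text \<open>Glues the diagonal and the product part of a maximal coupling. Space and sigma-algebra
  are taken from \<open>M\<close>, so the evaluation rule assumes that \<open>N\<close> has the same
  sets.\<close>

definition add_measure :: "'a measure \<Rightarrow> 'a measure \<Rightarrow> 'a measure" where
  "add_measure M N = measure_of (space M) (sets M) (\<lambda>A. emeasure M A + emeasure N A)"

lemma space_add_measure [simp]: "space (add_measure M N) = space M"
  and sets_add_measure [simp, measurable_cong]: "sets (add_measure M N) = sets M"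
  by (auto simp: add_measure_def)

lemma emeasure_add_measure:
  assumes "sets N = sets M" "A \<in> sets M"
  shows "emeasure (add_measure M N) A = emeasure M A + emeasure N A"
  unfolding add_measure_def
proof (rule emeasure_measure_of_sigma)
  show "countably_additive (sets M) (\<lambda>A. emeasure M A + emeasure N A)"
  proof (rule countably_additiveI)
    fix A :: "nat \<Rightarrow> _" assume "range A \<subseteq> sets M" "disjoint_family A"
    then show "(\<Sum>i. emeasure M (A i) + emeasure N (A i)) =
        emeasure M (\<Union> (range A)) + emeasure N (\<Union> (range A))"
      using assms(1) by (simp add: suminf_add [symmetric] suminf_emeasure)
  qed
qed (use assms in \<open>auto simp: positive_def sets.sigma_algebra_axioms\<close>)

section \<open>Total variation and maximal couplings\<close>

text \<open>The events \<open>X \<in> A\<close> and \<open>Z \<in> A\<close> can only differ where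
  \<open>X \<noteq> Z\<close>. This is the easy half of the identification with total variation:
  each set \<open>A\<close> gives a lower bound for every coupling.\<close>

lemma coupling2_measure_diff_le:
  assumes c: "coupling2 \<mu> \<nu> N X Z" and sets: "sets \<mu> = sets E" "sets \<nu> = sets E"
    and D: "{z \<in> space (E \<Otimes>\<^sub>M E). fst z \<noteq> snd z} \<in> sets (E \<Otimes>\<^sub>M E)"
    and A: "A \<in> sets E"
  shows "\<bar>measure \<mu> A - measure \<nu> A\<bar> \<le> \<P>(\<omega> in N. X \<omega> \<noteq> Z \<omega>)"
proof -
  have N: "prob_space N" and X: "X \<in> N \<rightarrow>\<^sub>M \<mu>" and Z: "Z \<in> N \<rightarrow>\<^sub>M \<nu>"
    and law: "distr N \<mu> X = \<mu>" "distr N \<nu> Z = \<nu>"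
    using c by (auto simp: coupling2_def)
  interpret prob_space N by fact
  have [measurable_cong]: "sets \<mu> = sets E" "sets \<nu> = sets E" by (fact sets)+
  have XE: "X \<in> N \<rightarrow>\<^sub>M E" and ZE: "Z \<in> N \<rightarrow>\<^sub>M E"
    using X Z sets by (simp_all cong: measurable_cong_sets)
  have neq: "{\<omega> \<in> space N. X \<omega> \<noteq> Z \<omega>} \<in> events"
    by (rule neq_event_measurable [OF D XE ZE])
  have ev: "X -` A \<inter> space N \<in> events" "Z -` A \<inter> space N \<in> events"
    using XE ZE A by (auto intro: measurable_sets)
  have "measure \<mu> A = prob (X -` A \<inter> space N)" "measure \<nu> A = prob (Z -` A \<inter> space N)"
    using measure_distr [OF X, of A] measure_distr [OF Z, of A] A sets law by auto
  moreover have "prob (X -` A \<inter> space N) \<le> prob (Z -` A \<inter> space N) + \<P>(\<omega> in N. X \<omega> \<noteq> Z \<omega>)"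
    using ev neq by (intro order_trans [OF finite_measure_mono measure_Un_le]) auto
  moreover have "prob (Z -` A \<inter> space N) \<le> prob (X -` A \<inter> space N) + \<P>(\<omega> in N. X \<omega> \<noteq> Z \<omega>)"
    using ev neq by (intro order_trans [OF finite_measure_mono measure_Un_le]) auto
  ultimately show ?thesis by linarith
qed

text \<open>The hypothesis \<open>a \<le> d\<close> covers \<open>d = 0\<close>: then
  \<open>a = 0\<close>, and the infinite inverse is multiplied by \<open>0\<close>, which gives
  \<open>0\<close>.\<close>

lemma ennreal_inverse_mult_cancel:
  fixes a d :: ennreal
  assumes "a \<le> d" "d < top"
  shows "inverse d * (a * d) = a"
proof (cases "d = 0")
  case False
  then show ?thesis
    using assms(2) ennreal_divide_self [of d]
    by (simp add: divide_ennreal_def mult.left_commute [of _ a] mult.commute [of "inverse d"])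
qed (use assms in auto)

text \<open>With \<open>Y\<close> a Hahn set on which \<open>\<mu>\<close> dominates \<open>\<nu>\<close>, the common part \<open>\<mu> \<and> \<nu>\<close> (that is, \<open>\<nu>\<close> on
  \<open>Y\<close> and \<open>\<mu>\<close> off \<open>Y\<close>) is put on the diagonal, and the remainders \<open>\<mu> - \<mu> \<and> \<nu>\<close> and
  \<open>\<nu> - \<mu> \<and> \<nu>\<close>, both of mass \<open>\<mu> Y - \<nu> Y\<close>, are coupled independently. When this mass is \<open>0\<close>,
  its inverse is \<open>\<infinity>\<close>, but the product of the remainders is the null measure.\<close>

lemma maximal_coupling2:
  fixes \<mu> \<nu> E :: "'a measure"
  assumes \<mu>: "prob_space \<mu>" and \<nu>: "prob_space \<nu>"
    and sets: "sets \<mu> = sets E" "sets \<nu> = sets E"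
    and D: "{z \<in> space (E \<Otimes>\<^sub>M E). fst z \<noteq> snd z} \<in> sets (E \<Otimes>\<^sub>M E)"
  obtains Y and N :: "('a \<times> 'a) measure" where
    "Y \<in> sets E" "coupling2 \<mu> \<nu> N fst snd"
    "\<P>(z in N. fst z \<noteq> snd z) \<le> measure \<mu> Y - measure \<nu> Y"
proof -
  interpret \<mu>: prob_space \<mu> by fact
  interpret \<nu>: prob_space \<nu> by fact
  note [measurable_cong] = sets
  have [simp]: "space \<mu> = space E" "space \<nu> = space E"
    using sets by (auto dest: sets_eq_imp_space_eq)
  obtain Y where Y: "Y \<in> sets E"
    and le: "\<And>X. X \<in> sets E \<Longrightarrow> X \<subseteq> Y \<Longrightarrow> emeasure \<nu> X \<le> emeasure \<mu> X"
    and ge: "\<And>X. X \<in> sets E \<Longrightarrow> X \<inter> Y = {} \<Longrightarrow> emeasure \<mu> X \<le> emeasure \<nu> X"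
    using finite_unsigned_Hahn_decomposition [of \<mu> \<nu>] sets \<mu>.finite_measure_axioms
      \<nu>.finite_measure_axioms by auto
  let ?Z = "space E - Y"
  have Z: "?Z \<in> sets E" using Y by auto
  define \<kappa> where "\<kappa> = add_measure (density \<nu> (indicator Y)) (density \<mu> (indicator ?Z))"
  \<comment> \<open>Cutting down to \<open>Y\<close> or \<open>?Z\<close> before subtracting makes
    the first measure dominate the second on every set, as \<open>emeasure_diff_measure\<close>
    demands.\<close>
  define \<alpha> where "\<alpha> = diff_measure (density \<mu> (indicator Y)) (density \<nu> (indicator Y))"
  define \<beta> where "\<beta> = diff_measure (density \<nu> (indicator ?Z)) (density \<mu> (indicator ?Z))"
  define \<delta> where "\<delta> = emeasure \<mu> Y - emeasure \<nu> Y"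
  define N where "N = add_measure (distr \<kappa> (E \<Otimes>\<^sub>M E) (\<lambda>x. (x, x)))
    (scale_measure (inverse \<delta>) (\<alpha> \<Otimes>\<^sub>M \<beta>))"
  have sets_\<kappa> [measurable_cong]: "sets \<kappa> = sets E"
    and sets_\<alpha> [measurable_cong]: "sets \<alpha> = sets E"
    and sets_\<beta> [measurable_cong]: "sets \<beta> = sets E"
    by (simp_all add: \<kappa>_def \<alpha>_def \<beta>_def sets)
  have space_\<kappa> [simp]: "space \<kappa> = space E"
    using sets_\<kappa> by (rule sets_eq_imp_space_eq)
  have \<kappa>: "emeasure \<kappa> A = emeasure \<nu> (Y \<inter> A) + emeasure \<mu> (?Z \<inter> A)" if "A \<in> sets E" for A
    using that Y Z by (simp add: \<kappa>_def emeasure_add_measure emeasure_restricted sets)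
  have \<alpha>: "emeasure \<alpha> A = emeasure \<mu> (Y \<inter> A) - emeasure \<nu> (Y \<inter> A)" if "A \<in> sets E" for A
    unfolding \<alpha>_def using that Y le
    by (subst emeasure_diff_measure)
       (auto simp: emeasure_restricted sets intro!: \<mu>.finite_measure_restricted
          \<nu>.finite_measure_restricted)
  have \<beta>: "emeasure \<beta> A = emeasure \<nu> (?Z \<inter> A) - emeasure \<mu> (?Z \<inter> A)" if "A \<in> sets E" for A
    unfolding \<beta>_def using that Z
    by (subst emeasure_diff_measure)
       (auto simp: emeasure_restricted sets intro!: \<mu>.finite_measure_restricted
          \<nu>.finite_measure_restricted ge)
  have split: "emeasure \<rho> A = emeasure \<rho> (Y \<inter> A) + emeasure \<rho> (?Z \<inter> A)"
    if "sets \<rho> = sets E" "A \<in> sets E" for \<rho> :: "'a measure" and A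
  proof -
    have "A = (Y \<inter> A) \<union> (?Z \<inter> A)" using sets.sets_into_space [OF that(2)] by auto
    then have "emeasure \<rho> A = emeasure \<rho> ((Y \<inter> A) \<union> (?Z \<inter> A))" by simp
    also have "\<dots> = emeasure \<rho> (Y \<inter> A) + emeasure \<rho> (?Z \<inter> A)"
      using that Y Z by (intro plus_emeasure [symmetric]) auto
    finally show ?thesis .
  qed
  have \<delta>: "\<delta> = ennreal (measure \<mu> Y - measure \<nu> Y)"
    by (simp add: \<delta>_def \<mu>.emeasure_eq_measure \<nu>.emeasure_eq_measure ennreal_minus)
  have \<alpha>_space: "emeasure \<alpha> (space E) = \<delta>"
    using Y sets.sets_into_space [OF Y] by (simp add: \<alpha> \<delta>_def Int_absorb2)
  \<comment> \<open>The remainders have equal mass because \<mu> and \<nu> both have total mass 1: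
    passing to the complement of \<open>Y\<close> reverses the sign of the difference.\<close>
  have \<beta>_space: "emeasure \<beta> (space E) = \<delta>"
  proof -
    have "measure \<mu> ?Z = 1 - measure \<mu> Y" "measure \<nu> ?Z = 1 - measure \<nu> Y"
      using \<mu>.prob_compl [of Y] \<nu>.prob_compl [of Y] Y sets by auto
    moreover have "?Z \<inter> space E = ?Z" by auto
    ultimately show ?thesis
      unfolding \<beta> [OF sets.top] \<delta>
      by (simp add: \<mu>.emeasure_eq_measure \<nu>.emeasure_eq_measure ennreal_minus)
  qed
  have \<alpha>_le: "emeasure \<alpha> A \<le> \<delta>" if "A \<in> sets E" for A
    unfolding \<alpha>_space [symmetric] using sets.sets_into_space [OF that]
    by (intro emeasure_mono) (auto simp: sets_\<alpha>)
  have \<beta>_le: "emeasure \<beta> A \<le> \<delta>" if "A \<in> sets E" for A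
    unfolding \<beta>_space [symmetric] using sets.sets_into_space [OF that]
    by (intro emeasure_mono) (auto simp: sets_\<beta>)
  have \<delta>_top: "\<delta> < top" by (simp add: \<delta>)
  \<comment> \<open>Finiteness of \<beta> is what allows the product measure to be evaluated on
    rectangles.\<close>
  have "finite_measure \<beta>"
    using \<beta>_space \<delta>_top sets_\<beta> by (intro finite_measureI) (auto dest: sets_eq_imp_space_eq)
  then interpret \<beta>: finite_measure \<beta> .
  have sets_prod: "sets (\<alpha> \<Otimes>\<^sub>M \<beta>) = sets (E \<Otimes>\<^sub>M E)"
    by (intro sets_pair_measure_cong sets_\<alpha> sets_\<beta>)
  have sets_N [measurable_cong]: "sets N = sets (E \<Otimes>\<^sub>M E)"
    by (simp add: N_def)
  have space_N: "space N = space E \<times> space E"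
    using sets_eq_imp_space_eq [OF sets_N] by (simp add: space_pair_measure)
  \<comment> \<open>Stated for all measurable \<open>B\<close>, since the disagreement event is not
    a rectangle; the marginals only need the rectangles below.\<close>
  have N: "emeasure N B = emeasure \<kappa> {x \<in> space E. (x, x) \<in> B} +
      inverse \<delta> * emeasure (\<alpha> \<Otimes>\<^sub>M \<beta>) B" if B: "B \<in> sets (E \<Otimes>\<^sub>M E)" for B
  proof -
    have "(\<lambda>x. (x, x)) -` B \<inter> space \<kappa> = {x \<in> space E. (x, x) \<in> B}" by auto
    then show ?thesis
      using B by (simp add: N_def emeasure_add_measure sets_prod emeasure_distr)
  qed
  have rect: "emeasure N (A \<times> B) = emeasure \<kappa> (A \<inter> B) +
      inverse \<delta> * (emeasure \<alpha> A * emeasure \<beta> B)" if "A \<in> sets E" "B \<in> sets E" for A B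
  proof -
    have "{x \<in> space E. (x, x) \<in> A \<times> B} = A \<inter> B"
      using sets.sets_into_space [OF that(1)] by auto
    then show ?thesis
      using that by (simp add: N \<beta>.emeasure_pair_measure_Times sets_\<alpha> sets_\<beta>)
  qed
  \<comment> \<open>The mass \<delta> of \<beta> cancels the factor \<open>inverse \<delta>\<close>,
    leaving \<kappa> + \<alpha>. On \<open>Y\<close> this is \<nu> + (\<mu> - \<nu>), off
    \<open>Y\<close> it is \<mu>.\<close>
  have 1: "emeasure N (A \<times> space E) = emeasure \<mu> A" if A: "A \<in> sets E" for A
  proof -
    have "emeasure N (A \<times> space E) = emeasure \<kappa> A + emeasure \<alpha> A"
      using A sets.sets_into_space [OF A] ennreal_inverse_mult_cancel [OF \<alpha>_le [OF A] \<delta>_top]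
      by (simp add: rect \<beta>_space Int_absorb2)
    also have "\<dots> = (emeasure \<nu> (Y \<inter> A) + (emeasure \<mu> (Y \<inter> A) - emeasure \<nu> (Y \<inter> A)))
        + emeasure \<mu> (?Z \<inter> A)"
      using A by (simp add: \<kappa> \<alpha> ac_simps)
    also have "\<dots> = emeasure \<mu> A"
      using A Y le by (simp add: add_diff_inverse_ennreal split [OF sets(1) A])
    finally show ?thesis .
  qed
  have 2: "emeasure N (space E \<times> A) = emeasure \<nu> A" if A: "A \<in> sets E" for A
  proof -
    have "emeasure N (space E \<times> A) = emeasure \<kappa> A + emeasure \<beta> A"
      using A sets.sets_into_space [OF A] ennreal_inverse_mult_cancel [OF \<beta>_le [OF A] \<delta>_top]
      by (simp add: rect \<alpha>_space Int_absorb1 mult.commute [of \<delta>])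
    also have "\<dots> = emeasure \<nu> (Y \<inter> A) +
        (emeasure \<mu> (?Z \<inter> A) + (emeasure \<nu> (?Z \<inter> A) - emeasure \<mu> (?Z \<inter> A)))"
      using A by (simp add: \<kappa> \<beta> ac_simps)
    also have "emeasure \<mu> (?Z \<inter> A) + (emeasure \<nu> (?Z \<inter> A) - emeasure \<mu> (?Z \<inter> A)) =
        emeasure \<nu> (?Z \<inter> A)"
      using A Z by (intro add_diff_inverse_ennreal ge) auto
    finally show ?thesis
      by (simp add: split [OF sets(2) A])
  qed
  have prob: "prob_space N"
    using 1 [OF sets.top] \<mu>.emeasure_space_1 by (intro prob_spaceI) (simp add: space_N)
  have "distr N \<mu> fst = \<mu>"
  proof (rule measure_eqI)
    fix A assume "A \<in> sets (distr N \<mu> fst)"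
    then have A: "A \<in> sets E" by (simp add: sets)
    have "fst -` A \<inter> space N = A \<times> space E"
      using sets.sets_into_space [OF A] by (auto simp: space_N)
    then show "emeasure (distr N \<mu> fst) A = emeasure \<mu> A"
      using A 1 [OF A] by (subst emeasure_distr) (auto simp: sets)
  qed simp
  moreover have "distr N \<nu> snd = \<nu>"
  proof (rule measure_eqI)
    fix A assume "A \<in> sets (distr N \<nu> snd)"
    then have A: "A \<in> sets E" by (simp add: sets)
    have "snd -` A \<inter> space N = space E \<times> A"
      using sets.sets_into_space [OF A] by (auto simp: space_N)
    then show "emeasure (distr N \<nu> snd) A = emeasure \<nu> A"
      using A 2 [OF A] by (subst emeasure_distr) (auto simp: sets)
  qed simp
  ultimately have cpl: "coupling2 \<mu> \<nu> N fst snd"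
    using prob by (simp add: coupling2_def)
  let ?D = "{z \<in> space (E \<Otimes>\<^sub>M E). fst z \<noteq> snd z}"
  \<comment> \<open>The diagonal part does not charge \<open>?D\<close>. What remains is at most the
    total mass of the normalized product, which is \<delta>.\<close>
  have "emeasure N ?D = inverse \<delta> * emeasure (\<alpha> \<Otimes>\<^sub>M \<beta>) ?D"
    by (simp add: N [OF D])
  also have "\<dots> \<le> inverse \<delta> * emeasure (\<alpha> \<Otimes>\<^sub>M \<beta>) (space E \<times> space E)"
    by (intro mult_left_mono emeasure_mono) (auto simp: space_pair_measure sets_prod)
  also have "\<dots> = \<delta>"
    using ennreal_inverse_mult_cancel [OF order_refl \<delta>_top]
    by (simp add: \<beta>.emeasure_pair_measure_Times sets_\<alpha> sets_\<beta> \<alpha>_space \<beta>_space)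
  finally have "emeasure N ?D \<le> \<delta>" .
  \<comment> \<open>Needed to return to real numbers: \<open>ennreal\<close> sends negative reals to
    \<open>0\<close>, so the bound by \<delta> alone would not yield the real inequality.\<close>
  moreover have "measure \<nu> Y \<le> measure \<mu> Y"
    using le [OF Y order_refl] by (simp add: \<mu>.emeasure_eq_measure \<nu>.emeasure_eq_measure)
  ultimately have "\<P>(z in N. fst z \<noteq> snd z) \<le> measure \<mu> Y - measure \<nu> Y"
    using prob by (simp add: \<delta> finite_measure.emeasure_eq_measure prob_space.finite_measure
        space_N space_pair_measure)
  then show thesis using Y cpl by (intro that)
qed

section \<open>The least disagreement probability as a distance between laws\<close>

text \<open>One set \<open>Y\<close>, optimal for \<mu> and \<nu>, serves all three terms: the left
  side is at most \<mu> Y - \<nu> Y, which splits at \<rho> Y, and every coupling with \<rho>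
  respects the two resulting differences. No couplings are composed.\<close>

lemma Inf_neq_prob_values_triangle:
  fixes \<mu> \<nu> \<rho> E :: "'a measure"
  assumes "prob_space \<mu>" "prob_space \<nu>" "prob_space \<rho>"
    and sets: "sets \<mu> = sets E" "sets \<nu> = sets E" "sets \<rho> = sets E"
    and D: "{z \<in> space (E \<Otimes>\<^sub>M E). fst z \<noteq> snd z} \<in> sets (E \<Otimes>\<^sub>M E)"
  shows "Inf (neq_prob_values \<mu> \<nu>) \<le> Inf (neq_prob_values \<rho> \<mu>) + Inf (neq_prob_values \<rho> \<nu>)"
proof -
  obtain Y and N :: "('a \<times> 'a) measure" where Y: "Y \<in> sets E" "coupling2 \<mu> \<nu> N fst snd"
    and le: "\<P>(z in N. fst z \<noteq> snd z) \<le> measure \<mu> Y - measure \<nu> Y"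
    by (rule maximal_coupling2 [OF assms(1,2) sets(1,2) D])
  have "Inf (neq_prob_values \<mu> \<nu>) \<le> measure \<mu> Y - measure \<nu> Y"
    using Y(2) le by (intro cInf_lower2 [OF _ le] neq_prob_values_bdd_below)
      (auto simp: neq_prob_values_def)
  moreover have "\<bar>measure \<rho> Y - measure \<mu> Y\<bar> \<le> Inf (neq_prob_values \<rho> \<mu>)"
    using coupling2_measure_diff_le [OF _ sets(3,1) D Y(1)]
    by (intro cInf_greatest neq_prob_values_nonempty assms) (auto simp: neq_prob_values_def)
  moreover have "\<bar>measure \<rho> Y - measure \<nu> Y\<bar> \<le> Inf (neq_prob_values \<rho> \<nu>)"
    using coupling2_measure_diff_le [OF _ sets(3,2) D Y(1)]
    by (intro cInf_greatest neq_prob_values_nonempty assms) (auto simp: neq_prob_values_def)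
  ultimately show ?thesis by linarith
qed

lemma Inf_neq_prob_values_self:
  fixes \<mu> E :: "'a measure"
  assumes "prob_space \<mu>" and sets: "sets \<mu> = sets E"
    and D: "{z \<in> space (E \<Otimes>\<^sub>M E). fst z \<noteq> snd z} \<in> sets (E \<Otimes>\<^sub>M E)"
  shows "Inf (neq_prob_values \<mu> \<mu>) = 0"
proof -
  \<comment> \<open>A variable coupled with itself never disagrees. This coupling lives on
    \<open>'a\<close> instead of pairs, so \<open>neq_prob_in_values\<close> carries it
    over.\<close>
  have "coupling2 \<mu> \<mu> \<mu> id id"
    using assms(1) by (simp add: coupling2_def id_def distr_id)
  from neq_prob_in_values [OF this sets sets D] have "0 \<in> neq_prob_values \<mu> \<mu>"
    by simp
  moreover have "x \<ge> 0" if "x \<in> neq_prob_values \<mu> \<mu>" for x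
    using that by (auto simp: neq_prob_values_def)
  ultimately show ?thesis
    by (intro antisym cInf_lower cInf_greatest neq_prob_values_bdd_below) auto
qed

lemma cINF_diff_const:
  fixes S :: "real set"
  assumes "S \<noteq> {}" "bdd_below S"
  shows "(INF d\<in>S. d - a) = Inf S - a"
  using Inf_add_eq [of "\<lambda>x. x" S "- a"] assms by simp

section \<open>Comparison of both measures when each property has two contexts\<close>

context random_system
begin

text \<open>For each \<open>p\<close>, the triangle inequality bounds every choice of
  \<open>Q p\<close> from below by the CbD term, and giving \<open>Q p\<close> the law of
  \<open>R (c1 p) p\<close> attains that bound, as one of the two summands vanishes.\<close>

lemma Delta0_eq_CbD_Delta0:
  assumes c12: "\<And>p. p \<in> P \<Longrightarrow> contexts_of C Pc p = {c1 p, c2 p} \<and> c1 p \<noteq> c2 p"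
  shows "Delta0 P C Pc E M R = CbD_Delta0 P E M R c1 c2"
  unfolding Delta0_def CbD_Delta0_def
proof (rule sum.cong [OF refl])
  fix p assume p: "p \<in> P"
  note D = neq_measurable [OF p]
  let ?\<mu> = "\<lambda>c. distr (M c) (E p) (R c p)"
  let ?f = "\<lambda>\<rho>. Inf (neq_prob_values \<rho> (?\<mu> (c1 p))) + Inf (neq_prob_values \<rho> (?\<mu> (c2 p)))"
  let ?S = "{?f (distr K (E p) Q) | (K :: 'a measure) Q. prob_space K \<and> Q \<in> K \<rightarrow>\<^sub>M E p}"
  have c: "c1 p \<in> C" "c2 p \<in> C" "p \<in> Pc (c1 p)" "p \<in> Pc (c2 p)" "c1 p \<noteq> c2 p"
    using c12 [OF p] by (auto simp: contexts_of_def)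
  have \<mu>: "prob_space (?\<mu> (c1 p))" "prob_space (?\<mu> (c2 p))"
    using c by (auto intro!: prob_space.prob_space_distr prob_space_M R_measurable)
  have ge: "Inf (neq_prob_values (?\<mu> (c1 p)) (?\<mu> (c2 p))) \<le> ?f \<rho>"
    if "prob_space \<rho>" "sets \<rho> = sets (E p)" for \<rho>
    using that by (intro Inf_neq_prob_values_triangle [OF \<mu> _ _ _ _ D]) auto
  have self: "Inf (neq_prob_values (?\<mu> (c1 p)) (?\<mu> (c1 p))) = 0"
    by (rule Inf_neq_prob_values_self [OF \<mu>(1) _ D]) simp
  \<comment> \<open>The minimizing choice is the identity on the value space, equipped with the law
    of the first variable.\<close>
  have "distr (?\<mu> (c1 p)) (E p) (\<lambda>x. x) = ?\<mu> (c1 p)"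
    by (rule distr_id2) simp
  then have "Inf (neq_prob_values (?\<mu> (c1 p)) (?\<mu> (c2 p))) =
      ?f (distr (?\<mu> (c1 p)) (E p) (\<lambda>x. x))"
    by (simp add: self)
  then have mem: "Inf (neq_prob_values (?\<mu> (c1 p)) (?\<mu> (c2 p))) \<in> ?S"
    using \<mu>(1) by (intro CollectI exI conjI) (assumption, auto)
  have "Inf ?S = Inf (neq_prob_values (?\<mu> (c1 p)) (?\<mu> (c2 p)))"
    by (rule cInf_eq_minimum [OF mem]) (auto intro!: ge prob_space.prob_space_distr)
  then show "Inf {\<Sum>c\<in>contexts_of C Pc p. Inf (neq_prob_values (distr K (E p) Q) (?\<mu> c)) |
        (K :: 'a measure) Q. prob_space K \<and> Q \<in> K \<rightarrow>\<^sub>M E p} =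
      Inf (neq_prob_values (?\<mu> (c1 p)) (?\<mu> (c2 p)))"
    using c12 [OF p] by simp
qed

lemma CbD_Delta_values_subset:
  assumes c12: "\<And>p. p \<in> P \<Longrightarrow> contexts_of C Pc p = {c1 p, c2 p} \<and> c1 p \<noteq> c2 p"
  shows "CbD_Delta_values P C Pc E M R c1 c2 \<subseteq> Delta_values P C Pc E M R"
proof
  fix d assume "d \<in> CbD_Delta_values P C Pc E M R c1 c2"
  then obtain N :: "('c \<Rightarrow> 'p \<Rightarrow> 'a) measure" and Rh where d: "d = CbD_Delta P c1 c2 N Rh"
    and cpl: "coupling C (\<lambda>c. vector_law (Pc c) E (M c) (R c)) N Rh"
    by (auto simp: CbD_Delta_values_def)
  define Q where "Q p \<omega> = Rh (c1 p) \<omega> p" for p \<omega>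
  have N: "prob_space N" and Rh: "\<And>c. c \<in> C \<Longrightarrow> Rh c \<in> N \<rightarrow>\<^sub>M Pi\<^sub>M (Pc c) E"
    using cpl by (auto simp: coupling_def measurable_vector_law)
  have "Q p \<in> N \<rightarrow>\<^sub>M E p" if "p \<in> P" for p
  proof -
    have "c1 p \<in> C" "p \<in> Pc (c1 p)" using c12 [OF that] by (auto simp: contexts_of_def)
    then show ?thesis
      unfolding Q_def using Rh measurable_component_singleton by (auto intro: measurable_compose)
  qed
  then have Q: "jointly_distributed P E N Q"
    using N by (simp add: jointly_distributed_def)
  have "random_vector (Pc c) Q \<in> N \<rightarrow>\<^sub>M Pi\<^sub>M (Pc c) E" if "c \<in> C" for c
    using Q Pc_subset [OF that] by (intro random_vector_measurable) (auto simp: jointly_distributed_def)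
  \<comment> \<open>All contexts share the sample space \<open>N\<close>, and each
    \<open>Qh c\<close> is the actual subvector of \<open>Q\<close>.\<close>
  then have "Q_couplings P C Pc E M R N Q (\<lambda>_. N) Rh (\<lambda>c. random_vector (Pc c) Q)"
    using Q cpl N by (auto simp: Q_couplings_def coupling2_def coupling_def measurable_vector_law)
      (simp add: vector_law_def cong: distr_cong)
  \<comment> \<open>The sample type of \<open>N\<close> is not the one fixed in
    \<open>Delta_values\<close>; \<open>Delta_in_values\<close> passes to the joint laws.\<close>
  then have "Delta P C Pc (\<lambda>_. N) Rh (\<lambda>c. random_vector (Pc c) Q) \<in> Delta_values P C Pc E M R"
    by (rule Delta_in_values)
  also have "Delta P C Pc (\<lambda>_. N) Rh (\<lambda>c. random_vector (Pc c) Q) = d"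
    unfolding Delta_def CbD_Delta_def d
  \<comment> \<open>The summand for \<open>c1 p\<close> is \<open>0\<close> by the choice of
    \<open>Q\<close>; as \<open>c1 p \<noteq> c2 p\<close>, the summand for \<open>c2 p\<close> is
    exactly the CbD term.\<close>
  proof (rule sum.cong [OF refl])
    fix p assume "p \<in> P"
    with c12 have c: "contexts_of C Pc p = {c1 p, c2 p}" "c1 p \<noteq> c2 p" by auto
    then have "p \<in> Pc (c1 p)" "p \<in> Pc (c2 p)" by (auto simp: contexts_of_def)
    then show "(\<Sum>c\<in>contexts_of C Pc p. \<P>(\<omega> in N. random_vector (Pc c) Q \<omega> p \<noteq> Rh c \<omega> p)) =
        \<P>(\<omega> in N. Rh (c1 p) \<omega> p \<noteq> Rh (c2 p) \<omega> p)"
      using c by (simp add: random_vector_def Q_def)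
  qed
  finally show "d \<in> Delta_values P C Pc E M R" .
qed

text \<open>The separate spaces \<open>N c\<close> do not relate bunches of different contexts. The
  joint realization \<open>L\<close> does, and keeps each pair law, hence each summand of
  \<open>Delta\<close>. Only domination is claimed because the triangle inequality can be
  strict.\<close>

lemma CbD_Delta_le_Delta:
  assumes real: "jointly_realizable P C Pc E M R"
    and c12: "\<And>p. p \<in> P \<Longrightarrow> contexts_of C Pc p = {c1 p, c2 p} \<and> c1 p \<noteq> c2 p"
    and d: "d \<in> Delta_values P C Pc E M R"
  shows "\<exists>d'\<in>CbD_Delta_values P C Pc E M R c1 c2. d' \<le> d"
proof -
  obtain K :: "('p \<Rightarrow> 'a) measure" and Q
      and N :: "'c \<Rightarrow> (('p \<Rightarrow> 'a) \<times> ('p \<Rightarrow> 'a)) measure" and Rh Qh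
    where d_eq: "d = Delta P C Pc N Rh Qh" and cpl: "Q_couplings P C Pc E M R K Q N Rh Qh"
    using d by (auto simp: Delta_values_def)
  obtain L :: "(('c \<Rightarrow> 'p \<Rightarrow> 'a) \<times> ('p \<Rightarrow> 'a)) measure" and R' Q'
    where Q': "jointly_distributed P E L Q'"
      and R': "\<And>c. c \<in> C \<Longrightarrow> R' c \<in> L \<rightarrow>\<^sub>M Pi\<^sub>M (Pc c) E"
      and law: "\<And>c. c \<in> C \<Longrightarrow> distr L (Pi\<^sub>M (Pc c) E \<Otimes>\<^sub>M Pi\<^sub>M (Pc c) E)
                  (\<lambda>\<omega>. (R' c \<omega>, random_vector (Pc c) Q' \<omega>)) =
              distr (N c) (Pi\<^sub>M (Pc c) E \<Otimes>\<^sub>M Pi\<^sub>M (Pc c) E) (\<lambda>\<omega>. (Rh c \<omega>, Qh c \<omega>))"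
    using real [unfolded jointly_realizable_def, rule_format, OF cpl] by auto
  have L: "prob_space L" using Q' by (simp add: jointly_distributed_def)
  have RV: "random_vector (Pc c) Q' \<in> L \<rightarrow>\<^sub>M Pi\<^sub>M (Pc c) E" if "c \<in> C" for c
    using Q' Pc_subset [OF that] by (intro random_vector_measurable) (auto simp: jointly_distributed_def)
  have hat: "Rh c \<in> N c \<rightarrow>\<^sub>M Pi\<^sub>M (Pc c) E" "Qh c \<in> N c \<rightarrow>\<^sub>M Pi\<^sub>M (Pc c) E"
      "distr (N c) (Pi\<^sub>M (Pc c) E) (Rh c) = vector_law (Pc c) E (M c) (R c)" if "c \<in> C" for c
    using cpl that
    by (auto simp: Q_couplings_def coupling2_def measurable_vector_law sets_vector_law
        cong: distr_cong)
  have law_R': "distr L (Pi\<^sub>M (Pc c) E) (R' c) = vector_law (Pc c) E (M c) (R c)"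
    if c: "c \<in> C" for c
  proof -
    have "distr L (Pi\<^sub>M (Pc c) E) (R' c) =
        distr (distr L (Pi\<^sub>M (Pc c) E \<Otimes>\<^sub>M Pi\<^sub>M (Pc c) E)
          (\<lambda>\<omega>. (R' c \<omega>, random_vector (Pc c) Q' \<omega>))) (Pi\<^sub>M (Pc c) E) fst"
      using R' [OF c] RV [OF c] by (subst distr_distr) (auto simp: comp_def)
    also have "\<dots> = distr (N c) (Pi\<^sub>M (Pc c) E) (Rh c)"
      unfolding law [OF c] using hat [OF c] by (subst distr_distr) (auto simp: comp_def)
    finally show ?thesis using hat(3) [OF c] by simp
  qed
  \<comment> \<open>Both sides are read off from the common law of the pair (bunch, part of
    \<open>Q\<close>) on \<open>?S\<close>.\<close>
  have prob: "\<P>(\<omega> in N c. Qh c \<omega> p \<noteq> Rh c \<omega> p) = \<P>(\<omega> in L. Q' p \<omega> \<noteq> R' c \<omega> p)"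
    if p: "p \<in> P" and c: "c \<in> C" "p \<in> Pc c" for p c
  proof -
    let ?S = "Pi\<^sub>M (Pc c) E \<Otimes>\<^sub>M Pi\<^sub>M (Pc c) E"
    have f [measurable]: "(\<lambda>x. x p) \<in> Pi\<^sub>M (Pc c) E \<rightarrow>\<^sub>M E p"
      using c(2) by (rule measurable_component_singleton)
    note [measurable] = R' [OF c(1)] RV [OF c(1)] hat(1,2) [OF c(1)]
    have "\<P>(\<omega> in N c. Qh c \<omega> p \<noteq> Rh c \<omega> p) =
        \<P>(x in distr (N c) ?S (\<lambda>\<omega>. (Rh c \<omega>, Qh c \<omega>)). snd x p \<noteq> fst x p)"
      by (subst prob_distr_neq [OF _ _ _ neq_measurable [OF p]]) auto
    also have "\<dots> = \<P>(\<omega> in L. random_vector (Pc c) Q' \<omega> p \<noteq> R' c \<omega> p)"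
      unfolding law [OF c(1), symmetric]
      by (subst prob_distr_neq [OF _ _ _ neq_measurable [OF p]]) auto
    finally show ?thesis using c(2) by (simp add: random_vector_def)
  qed
  have "coupling C (\<lambda>c. vector_law (Pc c) E (M c) (R c)) L R'"
    using L R' law_R'
    by (auto simp: coupling_def measurable_vector_law sets_vector_law cong: distr_cong)
  \<comment> \<open>\<open>L\<close> also carries \<open>Q'\<close> in its sample type;
    \<open>CbD_Delta_in_values\<close> passes to the law of the bunches alone.\<close>
  then have "CbD_Delta P c1 c2 L R' \<in> CbD_Delta_values P C Pc E M R c1 c2"
    using c12 by (intro CbD_Delta_in_values) auto
  moreover have "CbD_Delta P c1 c2 L R' \<le> d"
    unfolding CbD_Delta_def Delta_def d_eq
  proof (rule sum_mono)
    fix p assume p: "p \<in> P"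
    with c12 have ctx: "contexts_of C Pc p = {c1 p, c2 p}" "c1 p \<noteq> c2 p" by auto
    then have c: "c1 p \<in> C" "c2 p \<in> C" "p \<in> Pc (c1 p)" "p \<in> Pc (c2 p)"
      by (auto simp: contexts_of_def)
    have [measurable]: "Q' p \<in> L \<rightarrow>\<^sub>M E p"
      using Q' p by (simp add: jointly_distributed_def)
    have [measurable]: "(\<lambda>\<omega>. R' (c1 p) \<omega> p) \<in> L \<rightarrow>\<^sub>M E p" "(\<lambda>\<omega>. R' (c2 p) \<omega> p) \<in> L \<rightarrow>\<^sub>M E p"
      using R' c by (auto intro: measurable_compose measurable_component_singleton)
    have "\<P>(\<omega> in L. R' (c1 p) \<omega> p \<noteq> R' (c2 p) \<omega> p) \<le>
        \<P>(\<omega> in L. Q' p \<omega> \<noteq> R' (c1 p) \<omega> p) + \<P>(\<omega> in L. Q' p \<omega> \<noteq> R' (c2 p) \<omega> p)"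
      by (rule prob_neq_triangle [OF L neq_measurable [OF p]]) measurable
    then show "\<P>(\<omega> in L. R' (c1 p) \<omega> p \<noteq> R' (c2 p) \<omega> p) \<le>
        (\<Sum>c\<in>contexts_of C Pc p. \<P>(\<omega> in N c. Qh c \<omega> p \<noteq> Rh c \<omega> p))"
      using ctx c p by (simp add: prob)
  qed
  ultimately show ?thesis by blast
qed

end

theorem theorem15:
  fixes P :: "'p set" and C :: "'c set" and Pc :: "'c \<Rightarrow> 'p set"
    and E :: "'p \<Rightarrow> 'a measure" and M :: "'c \<Rightarrow> 'w measure" and R :: "'c \<Rightarrow> 'p \<Rightarrow> 'w \<Rightarrow> 'a"
    and c1 c2 :: "'p \<Rightarrow> 'c"
  assumes "random_system P C Pc E M R"
    and "jointly_realizable P C Pc E M R"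
    and "\<And>p. p \<in> P \<Longrightarrow> contexts_of C Pc p = {c1 p, c2 p} \<and> c1 p \<noteq> c2 p"
  shows "Inf (Delta_values P C Pc E M R) = Inf (CbD_Delta_values P C Pc E M R c1 c2) \<and>
    Delta0 P C Pc E M R = CbD_Delta0 P E M R c1 c2 \<and>
    (INF d \<in> Delta_values P C Pc E M R. d - Delta0 P C Pc E M R) =
      (INF d \<in> CbD_Delta_values P C Pc E M R c1 c2. d - CbD_Delta0 P E M R c1 c2)"
proof -
  interpret random_system P C Pc E M R by fact
  let ?D = "Delta_values P C Pc E M R" and ?B = "CbD_Delta_values P C Pc E M R c1 c2"
  have ne: "?D \<noteq> {}" using assms(3) by (intro Delta_values_nonempty) auto
  have "Inf ?D = Inf ?B"
  proof (rule antisym)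
    show "Inf ?D \<le> Inf ?B"
      by (intro cInf_superset_mono CbD_Delta_values_nonempty Delta_values_bdd_below
          CbD_Delta_values_subset assms(3))
    show "Inf ?B \<le> Inf ?D"
      by (intro cInf_mono ne CbD_Delta_values_bdd_below CbD_Delta_le_Delta assms(2,3))
  qed
  moreover have "Delta0 P C Pc E M R = CbD_Delta0 P E M R c1 c2"
    by (intro Delta0_eq_CbD_Delta0 assms(3))
  \<comment> \<open>Subtracting the common constant commutes with \<open>Inf\<close> on nonempty
    sets bounded below, so the third equation follows from the first two.\<close>
  ultimately show ?thesis
    using cINF_diff_const [OF ne Delta_values_bdd_below]
      cINF_diff_const [OF CbD_Delta_values_nonempty CbD_Delta_values_bdd_below]
    by simp
qed

end
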